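(* Let $W$ be a contact configuration with bounded cell and write $$g(W)=\min_{\theta\in S^3}\ \max_{w\in W}\ \langle\theta,w\rangle=\cos(\text{covering radius of }W).$$ The following are equivalent: (i) some $v\in S^3$ has $\langle v,w\rangle\le\frac12$ for all $w\in W$, that is, $W\cup\{v\}$ is again a contact configuration; (ii) $V_c(W)$ contains a point of norm $2$, that is, its circumradius is at least $2$; (iii) $g(W)\le\frac12$, that is, the covering radius of $W$ on $S^3$ is at least $60^\circ$.
   Context: A contact configuration is a finite set $W\subset S^3\subset\mathbb{R}^4$ of unit vectors with $\langle w,w'\rangle\le\frac12$ for all distinct $w,w'\in W$. Its cell is $V_c(W)=\{x\in\mathbb{R}^4:\langle x,w\rangle\le1\text{ for all }w\in W\}$. The circumradius of $V_c(W)$ means $\max\{|x|:x\in V_c(W)\}$ (distance measured from the origin). The covering radius of $W$ is $\max_{\theta\in S^3}\min_{w\in W}\arccos\langle\theta,w\rangle$. *)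

theory Defs
  imports "HOL-Analysis.Analysis"
begin

definition contact_configuration :: "(real ^ 4) set \<Rightarrow> bool" where
  "contact_configuration W \<longleftrightarrow>
     finite W \<and> W \<subseteq> sphere 0 1 \<and> (\<forall>w\<in>W. \<forall>w'\<in>W. w \<noteq> w' \<longrightarrow> w \<bullet> w' \<le> 1 / 2)"

definition contact_cell :: "(real ^ 4) set \<Rightarrow> (real ^ 4) set" where
  "contact_cell W = {x. \<forall>w\<in>W. x \<bullet> w \<le> 1}"

text \<open>
  The outer extrema below are written with \<open>SUP\<close> and \<open>INF\<close>. The lemmas at the end of this theory
  show that they are attained whenever \<open>W\<close> is finite and its cell is bounded (which forces
  \<open>W\<close> to be nonempty), so they are the intended maxima and minima.
\<close>

definition circumradius :: "(real ^ 4) set \<Rightarrow> real" where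
  "circumradius W = (SUP x\<in>contact_cell W. norm x)"

definition covering_radius :: "(real ^ 4) set \<Rightarrow> real" where
  "covering_radius W = (SUP \<theta>\<in>sphere 0 1. Min ((\<lambda>w. arccos (\<theta> \<bullet> w)) ` W))"

definition minimax_inner :: "(real ^ 4) set \<Rightarrow> real" where
  "minimax_inner W = (INF \<theta>\<in>sphere 0 1. Max ((\<lambda>w. \<theta> \<bullet> w) ` W))"

lemma bounded_cell_nonempty:
  assumes "bounded (contact_cell W)"
  shows "W \<noteq> {}"
  using assms by (auto simp: contact_cell_def)

lemma circumradius_attained:
  assumes "bounded (contact_cell W)"
  shows "\<exists>x\<in>contact_cell W. norm x = circumradius W \<and> (\<forall>y\<in>contact_cell W. norm y \<le> circumradius W)"
proof -
  have "contact_cell W = (\<Inter>w\<in>W. {x. w \<bullet> x \<le> 1})"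
    by (auto simp: contact_cell_def inner_commute)
  then have "closed (contact_cell W)"
    by (auto intro: closed_halfspace_le)
  then have "compact (contact_cell W)"
    using assms by (simp add: compact_eq_bounded_closed)
  moreover have "0 \<in> contact_cell W"
    by (simp add: contact_cell_def)
  ultimately obtain x where x: "x \<in> contact_cell W" "\<forall>y\<in>contact_cell W. norm y \<le> norm x"
    using continuous_attains_sup[of "contact_cell W" norm] continuous_on_norm_id by blast
  then have "circumradius W = norm x"
    unfolding circumradius_def by (intro cSup_eq_maximum) auto
  then show ?thesis
    using x by auto
qed

lemma continuous_on_Max_image:
  fixes f :: "'b \<Rightarrow> 'a::topological_space \<Rightarrow> real"
  assumes "finite W" "W \<noteq> {}" "\<And>w. w \<in> W \<Longrightarrow> continuous_on S (f w)"
  shows "continuous_on S (\<lambda>x. Max ((\<lambda>w. f w x) ` W))"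
  using assms by (induction W rule: finite_ne_induct) (auto intro!: continuous_on_max)

lemma continuous_on_Min_image:
  fixes f :: "'b \<Rightarrow> 'a::topological_space \<Rightarrow> real"
  assumes "finite W" "W \<noteq> {}" "\<And>w. w \<in> W \<Longrightarrow> continuous_on S (f w)"
  shows "continuous_on S (\<lambda>x. Min ((\<lambda>w. f w x) ` W))"
  using assms by (induction W rule: finite_ne_induct) (auto intro!: continuous_on_min)

lemma minimax_inner_attained:
  assumes "contact_configuration W" "W \<noteq> {}"
  shows "\<exists>\<theta>\<in>sphere 0 1. Max ((\<lambda>w. \<theta> \<bullet> w) ` W) = minimax_inner W \<and>
           (\<forall>\<eta>\<in>sphere 0 1. minimax_inner W \<le> Max ((\<lambda>w. \<eta> \<bullet> w) ` W))"
proof -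
  let ?f = "\<lambda>\<theta>. Max ((\<lambda>w. \<theta> \<bullet> w) ` W)"
  have "continuous_on (sphere 0 1) ?f"
    using assms by (intro continuous_on_Max_image continuous_intros) (auto simp: contact_configuration_def)
  moreover have "sphere (0 :: real ^ 4) 1 \<noteq> {}"
    by simp
  ultimately obtain \<theta> where \<theta>: "\<theta> \<in> sphere 0 1" "\<forall>\<eta>\<in>sphere 0 1. ?f \<theta> \<le> ?f \<eta>"
    using continuous_attains_inf[OF compact_sphere, of 0 1 ?f] by auto
  then have "minimax_inner W = ?f \<theta>"
    unfolding minimax_inner_def by (intro cInf_eq_minimum) (auto simp del: mem_sphere_0)
  with \<theta> show ?thesis
    by (intro bexI[of _ \<theta>]) simp_all
qed

lemma covering_radius_attained:
  assumes "contact_configuration W" "W \<noteq> {}"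
  shows "\<exists>\<theta>\<in>sphere 0 1. Min ((\<lambda>w. arccos (\<theta> \<bullet> w)) ` W) = covering_radius W \<and>
           (\<forall>\<eta>\<in>sphere 0 1. Min ((\<lambda>w. arccos (\<eta> \<bullet> w)) ` W) \<le> covering_radius W)"
proof -
  let ?f = "\<lambda>\<theta>. Min ((\<lambda>w. arccos (\<theta> \<bullet> w)) ` W)"
  have bd: "-1 \<le> \<theta> \<bullet> w \<and> \<theta> \<bullet> w \<le> 1" if "w \<in> W" "\<theta> \<in> sphere 0 1" for w \<theta>
    using Cauchy_Schwarz_ineq2[of \<theta> w] that assms by (auto simp: contact_configuration_def abs_le_iff subset_iff)
  have "continuous_on (sphere 0 1) ?f"
    using assms bd
    by (intro continuous_on_Min_image continuous_on_arccos continuous_intros)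
       (auto simp: contact_configuration_def)
  moreover have "sphere (0 :: real ^ 4) 1 \<noteq> {}"
    by simp
  ultimately obtain \<theta> where \<theta>: "\<theta> \<in> sphere 0 1" "\<forall>\<eta>\<in>sphere 0 1. ?f \<eta> \<le> ?f \<theta>"
    using continuous_attains_sup[OF compact_sphere, of 0 1 ?f] by auto
  then have "covering_radius W = ?f \<theta>"
    unfolding covering_radius_def by (intro cSup_eq_maximum) (auto simp del: mem_sphere_0)
  with \<theta> show ?thesis
    by (intro bexI[of _ \<theta>]) simp_all
qed

end

theory Submission
  imports Defs
begin

text \<open>All the conditions describe one set of directions: unit \<open>v\<close> with
  \<open>v \<bullet> w \<le> 1 / 2\<close> for every \<open>w\<close> in \<open>W\<close>. Doubling
  such a \<open>v\<close> gives a point of norm 2 in the cell, and halving such a point gives back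
  \<open>v\<close> (\<open>contact_cell_norm_2_iff\<close>). The cell is star-shaped about the
  origin, so its norms fill the whole interval from 0 to the circumradius; hence norm 2 occurs
  exactly when the circumradius is at least 2
  (\<open>contact_cell_norm_iff_circumradius_ge\<close>). By compactness of the sphere the minimum
  in \<open>minimax_inner\<close> is attained, so it is at most 1/2 exactly when such a
  \<open>v\<close> exists (\<open>minimax_inner_le_iff\<close>). Finally arccos is decreasing and so
  exchanges min and max, making the covering radius the arccos of the minimax
  (\<open>covering_radius_eq_arccos\<close>); the threshold 1/2 becomes
  \<open>pi / 3\<close>.\<close>

lemma Min_arccos_image:
  fixes f :: "'a \<Rightarrow> real"
  assumes "finite A" "A \<noteq> {}" "\<And>a. a \<in> A \<Longrightarrow> \<bar>f a\<bar> \<le> 1"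
  shows "Min ((\<lambda>a. arccos (f a)) ` A) = arccos (Max (f ` A))"
proof -
  obtain m where m: "m \<in> A" "Max (f ` A) = f m"
    using Max_in[of "f ` A"] assms(1,2) by blast
  have "f a \<le> f m" if "a \<in> A" for a
    using Max_ge[of "f ` A" "f a"] assms(1) that m(2) by simp
  then show ?thesis
    using assms m by (intro Min_eqI) (auto simp: abs_le_iff minus_le_iff intro!: arccos_le_arccos)
qed

lemma abs_inner_contact_le_1:
  assumes "contact_configuration W" "w \<in> W" "norm \<theta> = 1"
  shows "\<bar>\<theta> \<bullet> w\<bar> \<le> 1"
  using Cauchy_Schwarz_ineq2[of \<theta> w] assms by (auto simp: contact_configuration_def)

text \<open>The inner minimum of angles is the arccos of the inner maximum of inner products, so
  both outer extrema concern the same function of the direction. Since both are attained, each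
  inequality follows by testing one extremum at the point where the other is reached. The bound on
  the minimax keeps it where arccos is the inverse of cos.\<close>

lemma covering_radius_eq_arccos:
  assumes W: "contact_configuration W" "W \<noteq> {}"
  shows "\<bar>minimax_inner W\<bar> \<le> 1" "covering_radius W = arccos (minimax_inner W)"
proof -
  let ?g = "\<lambda>\<theta>. Max ((\<lambda>w. \<theta> \<bullet> w) ` W)"
  have fin: "finite W"
    using W by (simp add: contact_configuration_def)
  have Min_eq: "Min ((\<lambda>w. arccos (\<theta> \<bullet> w)) ` W) = arccos (?g \<theta>)" if "norm \<theta> = 1" for \<theta>
    by (rule Min_arccos_image[OF fin W(2) abs_inner_contact_le_1[OF W(1) _ that]])
  have g_bound: "\<bar>?g \<theta>\<bar> \<le> 1" if "norm \<theta> = 1" for \<theta>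
  proof -
    obtain w where "w \<in> W" "?g \<theta> = \<theta> \<bullet> w"
      using Max_in[of "(\<lambda>w. \<theta> \<bullet> w) ` W"] fin W(2) by blast
    then show ?thesis
      using abs_inner_contact_le_1[OF W(1) _ that] by simp
  qed
  obtain \<theta> where \<theta>: "norm \<theta> = 1" "?g \<theta> = minimax_inner W"
    and le: "\<And>\<eta>. norm \<eta> = 1 \<Longrightarrow> minimax_inner W \<le> ?g \<eta>"
    using minimax_inner_attained[OF W] by auto
  show bound: "\<bar>minimax_inner W\<bar> \<le> 1"
    using g_bound[OF \<theta>(1)] \<theta>(2) by simp
  obtain \<eta> where \<eta>: "norm \<eta> = 1" "arccos (?g \<eta>) = covering_radius W"
    and ge: "\<And>\<zeta>. norm \<zeta> = 1 \<Longrightarrow> arccos (?g \<zeta>) \<le> covering_radius W"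
    using covering_radius_attained[OF W] by (auto simp: Min_eq)
  show "covering_radius W = arccos (minimax_inner W)"
  proof (rule antisym)
    show "covering_radius W \<le> arccos (minimax_inner W)"
      using le[OF \<eta>(1)] g_bound[OF \<eta>(1)] bound
      unfolding \<eta>(2)[symmetric] by (intro arccos_le_arccos) auto
    show "arccos (minimax_inner W) \<le> covering_radius W"
      using ge[OF \<theta>(1)] \<theta>(2) by simp
  qed
qed

text \<open>Attainment matters in the forward direction: a mere infimum equal to \<open>c\<close>
  would not supply a direction \<open>v\<close>.\<close>

lemma minimax_inner_le_iff:
  assumes W: "contact_configuration W" "W \<noteq> {}"
  shows "minimax_inner W \<le> c \<longleftrightarrow> (\<exists>v\<in>sphere 0 1. \<forall>w\<in>W. v \<bullet> w \<le> c)"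
proof -
  have "finite W"
    using W by (simp add: contact_configuration_def)
  then have Max_le: "(\<forall>w\<in>W. v \<bullet> w \<le> c) \<longleftrightarrow> Max ((\<lambda>w. v \<bullet> w) ` W) \<le> c" for v
    using W by simp
  obtain \<theta> where \<theta>: "\<theta> \<in> sphere 0 1" "Max ((\<lambda>w. \<theta> \<bullet> w) ` W) = minimax_inner W"
    and le: "\<And>\<eta>. \<eta> \<in> sphere 0 1 \<Longrightarrow> minimax_inner W \<le> Max ((\<lambda>w. \<eta> \<bullet> w) ` W)"
    using minimax_inner_attained[OF W] by blast
  show ?thesis
    unfolding Max_le
  proof
    assume "minimax_inner W \<le> c"
    then show "\<exists>v\<in>sphere 0 1. Max ((\<lambda>w. v \<bullet> w) ` W) \<le> c"
      using \<theta> by (intro bexI[of _ \<theta>]) simp_all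
  next
    assume "\<exists>v\<in>sphere 0 1. Max ((\<lambda>w. v \<bullet> w) ` W) \<le> c"
    then show "minimax_inner W \<le> c"
      using le order_trans by blast
  qed
qed

lemma contact_cell_scaleR:
  assumes "x \<in> contact_cell W" "0 \<le> t" "t \<le> 1"
  shows "t *\<^sub>R x \<in> contact_cell W"
proof -
  have "t * (x \<bullet> w) \<le> 1" if "x \<bullet> w \<le> 1" for w
    using mult_left_mono[OF that \<open>0 \<le> t\<close>] \<open>t \<le> 1\<close> by simp
  then show ?thesis
    using assms(1) by (simp add: contact_cell_def)
qed

text \<open>Boundedness makes the circumradius an attained maximum; shrinking a farthest point
  towards the origin stays in the cell and reaches every smaller positive norm.\<close>

lemma contact_cell_norm_iff_circumradius_ge:
  assumes "bounded (contact_cell W)" "0 < r"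
  shows "(\<exists>x\<in>contact_cell W. norm x = r) \<longleftrightarrow> circumradius W \<ge> r"
proof
  assume "\<exists>x\<in>contact_cell W. norm x = r"
  then show "circumradius W \<ge> r"
    using circumradius_attained[OF assms(1)] by auto
next
  assume ge: "circumradius W \<ge> r"
  obtain x where x: "x \<in> contact_cell W" "norm x = circumradius W"
    using circumradius_attained[OF assms(1)] by blast
  \<comment> \<open>The factor lies between 0 and 1 because \<open>norm x\<close> is the
    circumradius, which is at least \<open>r > 0\<close>.\<close>
  have "(r / norm x) *\<^sub>R x \<in> contact_cell W"
    using x ge \<open>0 < r\<close> by (intro contact_cell_scaleR) (auto simp: divide_simps)
  moreover have "norm ((r / norm x) *\<^sub>R x) = r"
    using x ge \<open>0 < r\<close> by auto
  ultimately show "\<exists>x\<in>contact_cell W. norm x = r"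
    by blast
qed

lemma contact_cell_norm_2_iff:
  "(\<exists>x\<in>contact_cell W. norm x = 2) \<longleftrightarrow> (\<exists>v\<in>sphere 0 1. \<forall>w\<in>W. v \<bullet> w \<le> 1 / 2)"
proof
  assume "\<exists>x\<in>contact_cell W. norm x = 2"
  then obtain x where "x \<in> contact_cell W" "norm x = 2"
    by blast
  then show "\<exists>v\<in>sphere 0 1. \<forall>w\<in>W. v \<bullet> w \<le> 1 / 2"
    by (intro bexI[of _ "(1 / 2) *\<^sub>R x"]) (auto simp: contact_cell_def)
next
  assume "\<exists>v\<in>sphere 0 1. \<forall>w\<in>W. v \<bullet> w \<le> 1 / 2"
  then obtain v where "norm v = 1" "\<forall>w\<in>W. v \<bullet> w \<le> 1 / 2"
    by auto
  then show "\<exists>x\<in>contact_cell W. norm x = 2"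
    by (intro bexI[of _ "2 *\<^sub>R v"]) (auto simp: contact_cell_def)
qed

text \<open>The clause \<open>v \<notin> W\<close> rules out the degenerate extension: for
  \<open>v\<close> in \<open>W\<close> the union is \<open>W\<close> again, still a contact
  configuration, although \<open>v \<bullet> v = 1\<close> exceeds 1/2.\<close>

lemma contact_configuration_insert_iff:
  assumes "contact_configuration W" "v \<in> sphere 0 1"
  shows "(\<forall>w\<in>W. v \<bullet> w \<le> 1 / 2) \<longleftrightarrow> v \<notin> W \<and> contact_configuration (W \<union> {v})"
proof -
  have "v \<bullet> v = 1"
    using assms by (simp add: dot_square_norm)
  then have "v \<notin> W" if "\<forall>w\<in>W. v \<bullet> w \<le> 1 / 2"
    using that by force
  then show ?thesis
    using assms by (auto simp: contact_configuration_def inner_commute)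
qed

theorem proposition7p38:
  fixes W :: "(real ^ 4) set"
  assumes "contact_configuration W"
    and "bounded (contact_cell W)"
  shows "minimax_inner W = cos (covering_radius W) \<and>
    ((\<exists>v\<in>sphere 0 1. \<forall>w\<in>W. v \<bullet> w \<le> 1 / 2) \<longleftrightarrow> (\<exists>x\<in>contact_cell W. norm x = 2)) \<and>
    ((\<exists>x\<in>contact_cell W. norm x = 2) \<longleftrightarrow> minimax_inner W \<le> 1 / 2) \<and>
    (\<forall>v\<in>sphere 0 1. (\<forall>w\<in>W. v \<bullet> w \<le> 1 / 2) \<longleftrightarrow> v \<notin> W \<and> contact_configuration (W \<union> {v})) \<and>
    ((\<exists>x\<in>contact_cell W. norm x = 2) \<longleftrightarrow> circumradius W \<ge> 2) \<and>
    (minimax_inner W \<le> 1 / 2 \<longleftrightarrow> covering_radius W \<ge> pi / 3)"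
proof -
  \<comment> \<open>An empty \<open>W\<close> would have all of space as its cell, which is
    unbounded.\<close>
  have W: "contact_configuration W" "W \<noteq> {}"
    using assms bounded_cell_nonempty by auto
  have bound: "\<bar>minimax_inner W\<bar> \<le> 1"
    and cov: "covering_radius W = arccos (minimax_inner W)"
    using covering_radius_eq_arccos[OF W] by auto
  have "minimax_inner W = cos (covering_radius W)"
    using bound by (simp add: cov cos_arccos_abs)
  moreover have "minimax_inner W \<le> 1 / 2 \<longleftrightarrow> covering_radius W \<ge> pi / 3"
  proof -
    have "arccos (1 / 2) = pi / 3"
      by (rule arccos_unique) (auto simp: cos_60)
    then show ?thesis
      using bound arccos_le_mono[of "1 / 2" "minimax_inner W"] by (simp add: cov)
  qed
  ultimately show ?thesis
    using contact_cell_norm_2_iff[of W] minimax_inner_le_iff[OF W, of "1 / 2"]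
      contact_configuration_insert_iff[OF W(1)]
      contact_cell_norm_iff_circumradius_ge[OF assms(2), of 2]
    by (intro conjI ballI) simp_all
qed

end
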